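(* For every positive integer $n$, the set of insertion tableaux, under the Robinson--Schensted algorithm, of the noncrossing partial matchings on $[n]=\{1,\dots,n\}$ (viewed as involutions of $[n]$) is exactly the set of Richardson tableaux of size $n$.
   Context: A partial matching on $[n]$ is a set partition of $[n]$ into blocks of size one or two. It is identified with the involution $w$ of $[n]$ with $w(i)=i$ if $\{i\}$ is a block and $w(i)=j$ if $\{i,j\}$ is a block. A two-element block $\{i,j\}$ with $i<j$ is an arc $(i,j)$; two arcs $(i_1,j_1),(i_2,j_2)$ cross if $i_1<i_2<j_1<j_2$, and a partial matching is noncrossing if no two of its arcs cross. The insertion tableau of a partial matching is the Robinson--Schensted insertion tableau of the corresponding involution $w(1)w(2)\cdots w(n)$ (obtained by successively row-inserting $w(1),\dots,w(n)$ into the empty tableau). For a standard Young tableau $T$ of size $n$ and $1\le j\le n$, let $T_{\le j}$ be the subtableau formed by the entries $1,\dots,j$, and let $r_j(T)$ be the row containing $j$. $T$ is a Richardson tableau if for every $j$ with $r_j(T)\ge 2$, the largest entry of $T_{\le j}$ in row $r_j(T)-1$ is greater than every entry of $T_{\le j}$ lying in row $r_j(T)$ or strictly below it.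
   Formalization: In the Richardson condition, the largest entry in row r_j(T)-1 is compared with the entries of T_{≤j} other than j itself in row r_j(T) or below; read literally with j included, the claim fails for n=2 (the matching {1,2} gives the one-column tableau). *)

theory Defs
  imports Main "HOL-Library.Disjoint_Sets"
begin

definition partial_matching :: "nat \<Rightarrow> nat set set \<Rightarrow> bool" where
  "partial_matching n P \<longleftrightarrow> partition_on {1..n} P \<and> (\<forall>B\<in>P. card B = 1 \<or> card B = 2)"

definition arcs :: "nat set set \<Rightarrow> (nat \<times> nat) set" where
  "arcs P = {(i, j). i < j \<and> {i, j} \<in> P}"

definition crossing :: "nat \<times> nat \<Rightarrow> nat \<times> nat \<Rightarrow> bool" where
  "crossing a b \<longleftrightarrow> fst a < fst b \<and> fst b < snd a \<and> snd a < snd b"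

definition noncrossing_partial_matching :: "nat \<Rightarrow> nat set set \<Rightarrow> bool" where
  "noncrossing_partial_matching n P \<longleftrightarrow>
     partial_matching n P \<and> (\<forall>a\<in>arcs P. \<forall>b\<in>arcs P. \<not> crossing a b)"

definition matching_involution :: "nat set set \<Rightarrow> nat \<Rightarrow> nat" where
  "matching_involution P i = (if {i} \<in> P then i else (THE j. {i, j} \<in> P))"

definition matching_word :: "nat \<Rightarrow> nat set set \<Rightarrow> nat list" where
  "matching_word n P = map (matching_involution P) [1..<Suc n]"

text \<open>
  Tableaux are lists of rows, the top row first (English notation).
  \<open>row_insert x r\<close> returns the new row and the bumped entry, if any: \<open>x\<close> replaces the
  leftmost entry of \<open>r\<close> greater than \<open>x\<close>, or is appended at the end of \<open>r\<close>.
\<close>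

fun row_insert :: "nat \<Rightarrow> nat list \<Rightarrow> nat list \<times> nat option" where
  "row_insert x [] = ([x], None)"
| "row_insert x (y # ys) =
     (if x < y then (x # ys, Some y)
      else (let (zs, b) = row_insert x ys in (y # zs, b)))"

fun tableau_insert :: "nat \<Rightarrow> nat list list \<Rightarrow> nat list list" where
  "tableau_insert x [] = [[x]]"
| "tableau_insert x (r # rs) =
     (case row_insert x r of
        (r', None) \<Rightarrow> r' # rs
      | (r', Some y) \<Rightarrow> r' # tableau_insert y rs)"

definition insertion_tableau :: "nat list \<Rightarrow> nat list list" where
  "insertion_tableau ws = fold tableau_insert ws []"

definition standard_tableau :: "nat \<Rightarrow> nat list list \<Rightarrow> bool" where
  "standard_tableau n T \<longleftrightarrow>
     (\<forall>r\<in>set T. r \<noteq> []) \<and>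
     sorted_wrt (\<ge>) (map length T) \<and>
     (\<forall>r\<in>set T. sorted_wrt (<) r) \<and>
     (\<forall>i j. Suc i < length T \<and> j < length (T ! Suc i) \<longrightarrow> T ! i ! j < T ! Suc i ! j) \<and>
     distinct (concat T) \<and> set (concat T) = {1..n}"

text \<open>Rows are numbered from 1, whereas list positions start at 0.\<close>

definition tableau_row :: "nat list list \<Rightarrow> nat \<Rightarrow> nat set" where
  "tableau_row T k = (if 1 \<le> k \<and> k \<le> length T then set (T ! (k - 1)) else {})"

definition row_index :: "nat list list \<Rightarrow> nat \<Rightarrow> nat" where
  "row_index T j = (THE k. j \<in> tableau_row T k)"

definition restricted_row :: "nat list list \<Rightarrow> nat \<Rightarrow> nat \<Rightarrow> nat set" where
  "restricted_row T j k = {x \<in> tableau_row T k. x \<le> j}"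

text \<open>
  The entry \<open>j\<close> itself lies in row \<open>row_index T j\<close> and is the largest entry of the
  subtableau formed by \<open>1, \<dots>, j\<close>, so the comparison is with the entries other than \<open>j\<close>.
  The maximum is over a nonempty set: when \<open>T\<close> is standard, the entry directly above \<open>j\<close>
  belongs to it.
\<close>

definition richardson_tableau :: "nat \<Rightarrow> nat list list \<Rightarrow> bool" where
  "richardson_tableau n T \<longleftrightarrow>
     standard_tableau n T \<and>
     (\<forall>j\<in>{1..n}. row_index T j \<ge> 2 \<longrightarrow>
        (\<forall>k\<ge>row_index T j. \<forall>x\<in>restricted_row T j k - {j}.
           x < Max (restricted_row T j (row_index T j - 1))))"

end

theory Submission imports Defs begin

text \<open>
  If the last point \<open>b\<close> of a noncrossing involution \<open>f\<close> of \<open>{a, \<dots>, b}\<close> is not fixed, put \<open>i = f b\<close>;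
  then \<open>f\<close> preserves \<open>{a, \<dots>, i - 1}\<close> and \<open>{i + 1, \<dots>, b - 1}\<close>, and the word of \<open>f\<close> is \<open>u b v i\<close>. The
  letters of \<open>b v i\<close> exceed those of \<open>u\<close>, so the insertion tableau is the row-by-row juxtaposition
  of the tableau of \<open>u\<close> and the tableau of \<open>b v i\<close>; the latter arises from the tableau \<open>V\<close> of \<open>v\<close> by
  moving its first column down by one row, with \<open>i\<close> on top and \<open>b\<close> at the bottom. Conversely, if the
  largest entry \<open>b\<close> of a Richardson tableau is not in the first row, the reverse bumping path from
  \<open>b\<close> ends in some \<open>i\<close>, and the Richardson condition ensures that in each row the entries to
  the left of the path are smaller than \<open>i\<close>. Hence the tableau splits in the same way, and the two
  sets of tableaux satisfy the same recursion.
\<close>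

section \<open>Tableaux as families of row sets\<close>

text \<open>Rows are numbered from 0 here, unlike in \<open>tableau_row\<close>.\<close>

definition row :: "nat list list \<Rightarrow> nat \<Rightarrow> nat set" where
  "row T k = (if k < length T then set (T ! k) else {})"

definition row_sorted :: "nat list list \<Rightarrow> bool" where
  "row_sorted T \<longleftrightarrow> (\<forall>r\<in>set T. r \<noteq> [] \<and> sorted_wrt (<) r)"

text \<open>
  The Richardson condition for a family of rows filled with the elements of \<open>S\<close>. It forces the
  shape to be a partition and the columns to increase: two entries of a row are always separated
  in size by an entry of the row above.
\<close>

definition rich :: "nat set \<Rightarrow> (nat \<Rightarrow> nat set) \<Rightarrow> bool" where
  "rich S R \<longleftrightarrow> (\<Union>k. R k) = S \<and> (\<forall>k l. k \<noteq> l \<longrightarrow> R k \<inter> R l = {}) \<and>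
     (\<forall>k. \<forall>j\<in>R (Suc k). \<exists>y\<in>R k. y < j \<and> (\<forall>l>k. \<forall>x\<in>R l. x < j \<longrightarrow> x < y))"

text \<open>General intervals are needed because the recursion cuts out pieces that do not start at
  1. Only one direction of crossing is stated: a configuration \<open>f y < x < y < f x\<close> is
  excluded by the same clause applied to \<open>f y\<close>.\<close>

definition nc_involution :: "nat \<Rightarrow> nat \<Rightarrow> (nat \<Rightarrow> nat) \<Rightarrow> bool" where
  "nc_involution a b f \<longleftrightarrow> (\<forall>x\<in>{a..<b}. f x \<in> {a..<b} \<and> f (f x) = x) \<and>
     (\<forall>x\<in>{a..<b}. \<forall>y\<in>{a..<b}. x < y \<and> y < f x \<longrightarrow> f y \<le> f x)"

fun juxtapose :: "nat list list \<Rightarrow> nat list list \<Rightarrow> nat list list" where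
  "juxtapose [] W = W"
| "juxtapose U [] = U"
| "juxtapose (r # U) (s # W) = (r @ s) # juxtapose U W"

text \<open>The effect of inserting an entry that is smaller than all entries of the tableau.\<close>

fun push_column :: "nat \<Rightarrow> nat list list \<Rightarrow> nat list list" where
  "push_column x [] = [[x]]"
| "push_column x (s # W) = (x # tl s) # push_column (hd s) W"

lemma row_Nil [simp]: "row [] k = {}"
  by (simp add: row_def)

lemma row_Cons: "row (r # T) k = (case k of 0 \<Rightarrow> set r | Suc l \<Rightarrow> row T l)"
  by (cases k) (auto simp: row_def)

lemma Union_row: "(\<Union>k. row T k) = set (concat T)"
proof (intro equalityI subsetI)
  show "x \<in> set (concat T)" if "x \<in> (\<Union>k. row T k)" for x
    using that by (auto simp: row_def split: if_splits)
  show "x \<in> (\<Union>k. row T k)" if "x \<in> set (concat T)" for x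
  proof -
    obtain r where "r \<in> set T" "x \<in> set r" using \<open>x \<in> set (concat T)\<close> by auto
    then obtain k where "k < length T" "x \<in> set (T ! k)" by (metis in_set_conv_nth)
    then have "x \<in> row T k" by (simp add: row_def)
    then show ?thesis by blast
  qed
qed

lemma row_eq_tableau_row: "row T k = tableau_row T (Suc k)"
  by (auto simp: row_def tableau_row_def)

lemma row_eq_empty_iff: "row_sorted T \<Longrightarrow> row T k = {} \<longleftrightarrow> length T \<le> k"
  by (auto simp: row_def row_sorted_def)

text \<open>Strictly increasing rows are determined by their sets, and since no row is
  \<open>[]\<close>, the number of rows is determined too.\<close>

lemma row_sorted_eqI:
  assumes "row_sorted T" "row_sorted T'" "\<And>k. row T k = row T' k"
  shows "T = T'"
proof (rule nth_equalityI)
  show len: "length T = length T'"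
    using assms row_eq_empty_iff by (metis le_antisym order_refl)
  show "T ! k = T' ! k" if "k < length T" for k
    using assms(1,2) assms(3)[of k] that len
    by (intro sorted_distinct_set_unique) (auto simp: row_def row_sorted_def strict_sorted_iff)
qed

section \<open>Shape and columns of a Richardson family\<close>

text \<open>Disjoint nonempty rows are distinct subsets of \<open>S\<close>, so some row is empty;
  an empty row forces the next one to be empty, since every entry needs a witness in the row
  above.\<close>

lemma rich_nonempty_rows:
  assumes "rich S R" "finite S"
  obtains L where "\<And>k. R k = {} \<longleftrightarrow> L \<le> k"
proof -
  have "inj_on R {k. R k \<noteq> {}}"
    using assms(1) unfolding rich_def inj_on_def by blast
  moreover have "R ` {k. R k \<noteq> {}} \<subseteq> Pow S"
    using assms(1) by (auto simp: rich_def)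
  ultimately have "finite {k. R k \<noteq> {}}"
    using assms(2) by (meson finite_Pow_iff finite_subset inj_on_finite)
  then have ex: "\<exists>k. R k = {}"
    by (metis (mono_tags, lifting) UNIV_I ex_new_if_finite infinite_UNIV_nat mem_Collect_eq)
  define L where "L = (LEAST k. R k = {})"
  have "R L = {}"
    unfolding L_def by (rule LeastI_ex[OF ex])
  have "R k = {}" if "L \<le> k" for k
    using that
  proof (induction k rule: dec_induct)
    case base
    show ?case by fact
  next
    case (step k)
    then show ?case using assms(1) unfolding rich_def by blast
  qed
  moreover have "L \<le> k" if "R k = {}" for k
    unfolding L_def using that by (rule Least_le)
  ultimately show ?thesis using that by blast
qed

text \<open>Turns the families produced by splitting back into tableaux, to which an induction
  hypothesis can be applied.\<close>

lemma rich_list_tableau: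
  assumes "rich S R" "finite S"
  obtains T where "row_sorted T" "row T = R"
proof -
  obtain L where L: "\<And>k. R k = {} \<longleftrightarrow> L \<le> k"
    using rich_nonempty_rows[OF assms] by blast
  have fin: "finite (R k)" for k
    using assms unfolding rich_def by (metis UN_upper UNIV_I finite_subset)
  let ?T = "map (\<lambda>k. sorted_list_of_set (R k)) [0..<L]"
  have "row_sorted ?T"
    unfolding row_sorted_def using L fin by (auto simp: not_le[symmetric])
  moreover have "row ?T = R"
  proof
    show "row ?T k = R k" for k
      using fin[of k] L[of k] by (auto simp: row_def)
  qed
  ultimately show ?thesis using that by blast
qed

lemma rich_disjoint: "rich S R \<Longrightarrow> x \<in> R k \<Longrightarrow> x \<in> R l \<Longrightarrow> k = l"
  unfolding rich_def by blast

text \<open>Induction along row \<open>Suc i\<close>: two neighbours in it are separated by an entry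
  of row \<open>i\<close>, so each move to the right uses up at least one further entry of row
  \<open>i\<close>.\<close>

lemma rich_columns:
  assumes "row_sorted T" "rich S (row T)" "Suc i < length T"
  shows "j < length (T ! Suc i) \<Longrightarrow> j < length (T ! i) \<and> T ! i ! j < T ! Suc i ! j"
proof (induction j)
  case 0
  then have "T ! Suc i ! 0 \<in> row T (Suc i)"
    using assms(3) by (simp add: row_def)
  then obtain y where "y \<in> row T i" "y < T ! Suc i ! 0"
    using assms(2) unfolding rich_def by blast
  moreover have "sorted (T ! i)"
    using assms(1,3) by (simp add: row_sorted_def strict_sorted_iff)
  ultimately show ?case
    using assms(3) by (auto simp: row_def in_set_conv_nth)
      (metis (no_types, lifting) le0 le_less_trans sorted_nth_mono)
next
  case (Suc j)
  let ?z = "T ! Suc i ! Suc j"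
  have "?z \<in> row T (Suc i)" "T ! Suc i ! j \<in> row T (Suc i)"
    using assms(3) Suc.prems by (simp_all add: row_def)
  moreover have "T ! Suc i ! j < ?z"
    using assms(1,3) Suc.prems by (simp add: row_sorted_def sorted_wrt_nth_less)
  ultimately obtain y where y: "y \<in> row T i" "y < ?z" "T ! Suc i ! j < y"
    using assms(2) unfolding rich_def by (metis lessI)
  then obtain q where q: "q < length (T ! i)" "y = T ! i ! q"
    using assms(3) by (auto simp: row_def in_set_conv_nth)
  have sorted: "sorted (T ! i)"
    using assms(1,3) by (simp add: row_sorted_def strict_sorted_iff)
  have IH: "j < length (T ! i)" "T ! i ! j < T ! Suc i ! j"
    using Suc by simp_all
  have "j < q"
  proof (rule ccontr)
    assume "\<not> j < q"
    then have "y \<le> T ! i ! j"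
      using sorted IH(1) q by (simp add: sorted_nth_mono)
    then show False using IH(2) y(3) by linarith
  qed
  moreover from this have "T ! i ! Suc j \<le> y"
    using sorted q by (simp add: sorted_nth_mono)
  ultimately show ?case using q y(2) by linarith
qed

lemma standard_tableau_of_rich:
  assumes "row_sorted T" "rich {1..n} (row T)"
  shows "standard_tableau n T"
proof -
  have cols: "j < length (T ! i) \<and> T ! i ! j < T ! Suc i ! j"
    if "Suc i < length T" "j < length (T ! Suc i)" for i j
    using rich_columns[OF assms that] .
  have "length (T ! Suc i) \<le> length (T ! i)" if "Suc i < length T" for i
    using cols[OF that] by (meson le_refl not_le)
  then have "sorted_wrt (\<ge>) (map length T)"
    using sorted_wrt_iff_nth_Suc_transp[of "(\<ge>) :: nat \<Rightarrow> _" "map length T"] by simp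
  moreover have "distinct (concat T)"
  proof (rule distinct_concat)
    have disj: "set (T ! i) \<inter> set (T ! j) = {}" if "i < length T" "j < length T" "i \<noteq> j" for i j
    proof -
      have "row T i \<inter> row T j = {}"
        using assms(2) that(3) by (simp add: rich_def)
      then show ?thesis using that by (simp add: row_def)
    qed
    show "distinct T"
      unfolding distinct_conv_nth
    proof (intro allI impI)
      fix i j assume "i < length T" "j < length T" "i \<noteq> j"
      then show "T ! i \<noteq> T ! j"
        using disj[of i j] assms(1) unfolding row_sorted_def by (metis Int_absorb nth_mem set_empty)
    qed
    show "distinct r" if "r \<in> set T" for r
      using that assms(1) by (simp add: row_sorted_def strict_sorted_iff)
    show "set r \<inter> set s = {}" if "r \<in> set T" "s \<in> set T" "r \<noteq> s" for r s
      using that disj by (metis in_set_conv_nth)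
  qed
  moreover have "set (concat T) = {1..n}"
    using assms(2) Union_row[of T] unfolding rich_def by simp
  moreover have "\<forall>r\<in>set T. r \<noteq> []" "\<forall>r\<in>set T. sorted_wrt (<) r"
    using assms(1) by (auto simp: row_sorted_def)
  ultimately show ?thesis
    using cols by (simp add: standard_tableau_def del: set_concat)
qed

section \<open>The Richardson condition on standard tableaux\<close>

lemma standard_tableau_row:
  assumes "standard_tableau n T"
  shows "row_sorted T" "(\<Union>k. row T k) = {1..n}" "\<And>k l. k \<noteq> l \<Longrightarrow> row T k \<inter> row T l = {}"
proof -
  show "row_sorted T" "(\<Union>k. row T k) = {1..n}"
    using assms by (simp_all add: standard_tableau_def row_sorted_def Union_row del: set_concat)
  have dist: "distinct (concat T)"
    using assms by (simp add: standard_tableau_def)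
  have disj: "set (T ! i) \<inter> set (T ! j) = {}" if "i < length T" "j < length T" "i < j" for i j
  proof -
    have "concat T = concat (take j T) @ concat (drop j T)"
      by (metis append_take_drop_id concat_append)
    then have "set (concat (take j T)) \<inter> set (concat (drop j T)) = {}"
      using dist by (metis distinct_append)
    moreover have "T ! i \<in> set (take j T)" "T ! j \<in> set (drop j T)"
      using that by (auto simp: in_set_conv_nth intro: exI[of _ i] exI[of _ 0])
    ultimately show ?thesis by (auto 0 4)
  qed
  show "row T k \<inter> row T l = {}" if "k \<noteq> l" for k l
    using that disj[of k l] disj[of l k] by (cases "k < l") (auto simp: row_def)
qed

text \<open>The \<open>Suc\<close> is the shift between rows counted from 0 in \<open>row\<close>
  and from 1 in \<open>tableau_row\<close>.\<close>

lemma row_index_eq: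
  assumes "\<And>k l. k \<noteq> l \<Longrightarrow> row T k \<inter> row T l = {}" "j \<in> row T k"
  shows "row_index T j = Suc k"
  unfolding row_index_def
proof (rule the_equality)
  show "j \<in> tableau_row T (Suc k)"
    using assms(2) by (simp add: row_eq_tableau_row)
  show "l = Suc k" if "j \<in> tableau_row T l" for l
  proof -
    have "1 \<le> l" using that by (auto simp: tableau_row_def split: if_splits)
    then show ?thesis using that assms by (cases l) (auto simp: row_eq_tableau_row)
  qed
qed

text \<open>The maximum in the definition is the best possible witness \<open>y\<close>, so a bound
  by \<open>Max\<close> amounts to the existence of a witness. Standardness is recovered from
  \<open>rich\<close> by \<open>standard_tableau_of_rich\<close>.\<close>

lemma richardson_tableau_iff: "richardson_tableau n T \<longleftrightarrow> row_sorted T \<and> rich {1..n} (row T)"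
proof -
  have "(\<forall>j\<in>{1..n}. row_index T j \<ge> 2 \<longrightarrow>
        (\<forall>k\<ge>row_index T j. \<forall>x\<in>restricted_row T j k - {j}.
           x < Max (restricted_row T j (row_index T j - 1)))) \<longleftrightarrow>
     (\<forall>k. \<forall>j\<in>row T (Suc k). \<exists>y\<in>row T k. y < j \<and> (\<forall>l>k. \<forall>x\<in>row T l. x < j \<longrightarrow> x < y))"
    (is "?A \<longleftrightarrow> ?B") if std: "standard_tableau n T"
  proof -
    note rows = standard_tableau_row[OF std]
    have res: "restricted_row T j (Suc k) = {x \<in> row T k. x \<le> j}" for j k
      by (simp add: restricted_row_def row_eq_tableau_row)
    have fin: "finite {x \<in> row T k. x \<le> j}" for j k
      by (rule finite_subset[of _ "{..j}"]) auto
    have step: "(\<forall>m\<ge>row_index T j. \<forall>x\<in>restricted_row T j m - {j}.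
           x < Max (restricted_row T j (row_index T j - 1))) \<longleftrightarrow>
        (\<exists>y\<in>row T k. y < j \<and> (\<forall>l>k. \<forall>x\<in>row T l. x < j \<longrightarrow> x < y))" (is "?C \<longleftrightarrow> ?D")
      if j: "j \<in> row T (Suc k)" for j k
    proof -
      have ri: "row_index T j = Suc (Suc k)"
        using rows(3) j by (rule row_index_eq)
      let ?M = "{x \<in> row T k. x \<le> j}"
      \<comment> \<open>The entry directly above \<open>j\<close> makes \<open>?M\<close> nonempty,
        so that \<open>Max ?M\<close> is one of its members.\<close>
      have above: "\<exists>y\<in>row T k. y < j"
      proof -
        obtain p where p: "Suc k < length T" "p < length (T ! Suc k)" "j = T ! Suc k ! p"
          using j by (auto simp: row_def in_set_conv_nth split: if_splits)
        have "sorted_wrt (\<ge>) (map length T)"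
          using std by (simp add: standard_tableau_def)
        then have "length (T ! Suc k) \<le> length (T ! k)"
          using p(1) by (auto simp: sorted_wrt_iff_nth_less)
        moreover have "T ! k ! p < j"
          using std p by (simp add: standard_tableau_def)
        ultimately show ?thesis
          using p by (intro bexI[of _ "T ! k ! p"]) (auto simp: row_def)
      qed
      have "j \<notin> row T k"
        using rows(3)[of k "Suc k"] j by (metis disjoint_iff n_not_Suc_n)
      moreover have "Max ?M \<in> ?M"
        using above by (intro Max_in[OF fin]) (auto dest: less_imp_le)
      ultimately have max: "Max ?M \<in> row T k" "Max ?M < j"
        by (auto simp del: Max_less_iff Max_gr_iff) (metis le_neq_implies_less)
      have C: "?C \<longleftrightarrow> (\<forall>l>k. \<forall>x\<in>row T l. x < j \<longrightarrow> x < Max ?M)"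
      proof -
        have "?C \<longleftrightarrow> (\<forall>m\<ge>Suc (Suc k). \<forall>x\<in>restricted_row T j m - {j}. x < Max ?M)"
          by (simp add: ri res)
        also have "\<dots> \<longleftrightarrow> (\<forall>l>k. \<forall>x\<in>restricted_row T j (Suc l) - {j}. x < Max ?M)"
        proof (intro iffI allI impI)
          fix m
          assume *: "\<forall>l>k. \<forall>x\<in>restricted_row T j (Suc l) - {j}. x < Max ?M" "Suc (Suc k) \<le> m"
          obtain l where "m = Suc l" using *(2) by (cases m) auto
          then show "\<forall>x\<in>restricted_row T j m - {j}. x < Max ?M"
            using * by (simp add: Suc_le_eq del: Max_less_iff Max_gr_iff)
        qed (meson Suc_leI Suc_le_mono)
        also have "\<dots> \<longleftrightarrow> (\<forall>l>k. \<forall>x\<in>row T l. x < j \<longrightarrow> x < Max ?M)"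
          unfolding res order.strict_iff_order[of _ j] by blast
        finally show ?thesis .
      qed
      show ?thesis
      proof
        assume ?C
        then show ?D using max C by blast
      next
        assume ?D
        then obtain y where y: "y \<in> row T k" "y < j" "\<forall>l>k. \<forall>x\<in>row T l. x < j \<longrightarrow> x < y"
          by blast
        have "y \<le> Max ?M" using y fin by (intro Max_ge) auto
        then show ?C unfolding C using y(3) by (meson less_le_trans)
      qed
    qed
    have idx: "j \<in> {1..n} \<and> row_index T j \<ge> 2 \<longleftrightarrow> (\<exists>k. j \<in> row T (Suc k))" for j
    proof
      assume j: "j \<in> {1..n} \<and> row_index T j \<ge> 2"
      then obtain k where k: "j \<in> row T k" using rows(2) by blast
      then have "row_index T j = Suc k" using row_index_eq rows(3) by blast
      then show "\<exists>k. j \<in> row T (Suc k)" using j k by (cases k) auto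
    next
      assume "\<exists>k. j \<in> row T (Suc k)"
      then obtain k where k: "j \<in> row T (Suc k)" by blast
      then have "row_index T j = Suc (Suc k)" using row_index_eq rows(3) by blast
      then show "j \<in> {1..n} \<and> row_index T j \<ge> 2" using k rows(2) by auto
    qed
    show ?thesis
    proof
      assume A: ?A
      show ?B
      proof (intro allI ballI)
        fix k j assume j: "j \<in> row T (Suc k)"
        then have "j \<in> {1..n} \<and> row_index T j \<ge> 2" using idx by blast
        then show "\<exists>y\<in>row T k. y < j \<and> (\<forall>l>k. \<forall>x\<in>row T l. x < j \<longrightarrow> x < y)"
          using A by (intro iffD1[OF step[OF j]]) blast
      qed
    next
      assume B: ?B
      show ?A
      proof (intro ballI impI)
        fix j assume "j \<in> {1..n}" "row_index T j \<ge> 2"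
        then obtain k where j: "j \<in> row T (Suc k)" using idx by blast
        show "\<forall>k\<ge>row_index T j. \<forall>x\<in>restricted_row T j k - {j}.
           x < Max (restricted_row T j (row_index T j - 1))"
          using B j by (intro iffD2[OF step[OF j]]) blast
      qed
    qed
  qed
  note equiv = this
  have "richardson_tableau n T \<longleftrightarrow> standard_tableau n T \<and> rich {1..n} (row T)"
  proof (cases "standard_tableau n T")
    case True
    have disj: "\<forall>k l. k \<noteq> l \<longrightarrow> row T k \<inter> row T l = {}"
      using standard_tableau_row(3)[OF True] by simp
    show ?thesis
      unfolding richardson_tableau_def rich_def equiv[OF True] standard_tableau_row(2)[OF True]
      by (simp only: eqTrueI[OF True] eqTrueI[OF disj] simp_thms)
  qed (simp add: richardson_tableau_def)
  then show ?thesis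
    using standard_tableau_of_rich standard_tableau_row(1) by blast
qed

section \<open>Splitting Richardson families\<close>

lemma richI:
  assumes "(\<Union>k. R k) = S" "\<And>k l x. x \<in> R k \<Longrightarrow> x \<in> R l \<Longrightarrow> k = l"
    "\<And>k j. j \<in> R (Suc k) \<Longrightarrow> \<exists>y\<in>R k. y < j \<and> (\<forall>l>k. \<forall>x\<in>R l. x < j \<longrightarrow> x < y)"
  shows "rich S R"
  using assms unfolding rich_def by (metis disjoint_iff)

lemma richE:
  assumes "rich S R" "j \<in> R (Suc k)"
  obtains y where "y \<in> R k" "y < j" "\<And>l x. k < l \<Longrightarrow> x \<in> R l \<Longrightarrow> x < j \<Longrightarrow> x < y"
  using assms unfolding rich_def by metis

lemma rich_Union: "rich S R \<Longrightarrow> x \<in> S \<longleftrightarrow> (\<exists>k. x \<in> R k)"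
  unfolding rich_def by blast

text \<open>Row 0 is neither the row of a \<open>j\<close> nor a row \<open>l > k\<close>, so
  enlarging it only adds candidate witnesses; the rows stay disjoint because \<open>b\<close> is
  new.\<close>

lemma rich_append_max:
  assumes "rich {a..<b} R" "a \<le> b"
  shows "rich {a..<Suc b} (R(0 := insert b (R 0)))"
proof (rule richI)
  have lt: "x < b" if "x \<in> R k" for x k
    using rich_Union[OF assms(1), of x] that by auto
  show "(\<Union>k. (R(0 := insert b (R 0))) k) = {a..<Suc b}"
  proof (intro set_eqI)
    fix x
    have "x \<in> (\<Union>k. (R(0 := insert b (R 0))) k) \<longleftrightarrow> x = b \<or> (\<exists>k. x \<in> R k)"
      by (auto, metis)
    also have "\<dots> \<longleftrightarrow> x \<in> {a..<Suc b}"
      using rich_Union[OF assms(1), of x] assms(2) by auto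
    finally show "x \<in> (\<Union>k. (R(0 := insert b (R 0))) k) \<longleftrightarrow> x \<in> {a..<Suc b}" .
  qed
  show "k = l" if "x \<in> (R(0 := insert b (R 0))) k" "x \<in> (R(0 := insert b (R 0))) l" for k l x
    using that lt rich_disjoint[OF assms(1), of x] by (auto split: if_splits)
  fix k j
  assume "j \<in> (R(0 := insert b (R 0))) (Suc k)"
  then have "j \<in> R (Suc k)" by simp
  then obtain y where y: "y \<in> R k" "y < j" "\<And>l x. k < l \<Longrightarrow> x \<in> R l \<Longrightarrow> x < j \<Longrightarrow> x < y"
    using richE[OF assms(1)] by metis
  then show "\<exists>y\<in>(R(0 := insert b (R 0))) k. y < j \<and>
      (\<forall>l>k. \<forall>x\<in>(R(0 := insert b (R 0))) l. x < j \<longrightarrow> x < y)"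
    by (intro bexI[of _ y]) auto
qed

text \<open>The witness for \<open>j\<close> is smaller than \<open>j\<close>, so it survives the
  truncation, and it has no additional entries to exceed.\<close>

lemma rich_restrict:
  assumes "rich S R"
  shows "rich {x \<in> S. x < i} (\<lambda>k. {x \<in> R k. x < i})"
proof (rule richI)
  show "(\<Union>k. {x \<in> R k. x < i}) = {x \<in> S. x < i}"
    using rich_Union[OF assms] by auto
  show "k = l" if "x \<in> {x \<in> R k. x < i}" "x \<in> {x \<in> R l. x < i}" for k l x
    using that rich_disjoint[OF assms, of x k l] by simp
  show "\<exists>y\<in>{x \<in> R k. x < i}. y < j \<and> (\<forall>l>k. \<forall>x\<in>{x \<in> R l. x < i}. x < j \<longrightarrow> x < y)"
    if "j \<in> {x \<in> R (Suc k). x < i}" for k j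
  proof -
    have j: "j \<in> R (Suc k)" "j < i" using that by simp_all
    obtain y where y: "y \<in> R k" "y < j" "\<And>l x. k < l \<Longrightarrow> x \<in> R l \<Longrightarrow> x < j \<Longrightarrow> x < y"
      using richE[OF assms j(1)] by metis
    then show ?thesis using j(2) by (intro bexI[of _ y]) auto
  qed
qed

text \<open>\<open>d\<close> is the shifted column: \<open>i\<close>, the minima of the
  \<open>L\<close> rows of \<open>V\<close>, then \<open>b\<close>. Row \<open>k\<close> loses
  \<open>d (Suc k)\<close> and gains \<open>d k\<close>. Entries of \<open>U\<close> and unmoved
  entries of \<open>V\<close> keep a witness; the witness for \<open>d (Suc k)\<close> is
  \<open>d k\<close>, because all entries smaller than \<open>d (Suc k)\<close> in rows after
  \<open>k\<close> come from \<open>U\<close>.\<close>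

lemma rich_compose:
  assumes U: "rich {a..<i} U" and V: "rich {Suc i..<b} V" and ib: "a \<le> i" "i < b"
    and L: "\<And>k. V k = {} \<longleftrightarrow> L \<le> k"
    and d0: "d 0 = i" and dL: "d (Suc L) = b"
    and d: "\<And>k. k < L \<Longrightarrow> d (Suc k) \<in> V k" "\<And>k x. k < L \<Longrightarrow> x \<in> V k \<Longrightarrow> d (Suc k) \<le> x"
    and R: "\<And>k. R k = U k \<union> (V k - {d (Suc k)}) \<union> (if k \<le> Suc L then {d k} else {})"
  shows "rich {a..<Suc b} R"
proof (rule richI)
  have inU: "a \<le> x \<and> x < i" if "x \<in> U k" for x k
    using rich_Union[OF U, of x] that by auto
  have inV: "i < x \<and> x < b" "k < L" if "x \<in> V k" for x k
  proof -
    show "i < x \<and> x < b" using rich_Union[OF V, of x] that by auto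
    show "k < L" using L[of k] that by (metis empty_iff not_le)
  qed
  \<comment> \<open>A row minimum of \<open>V\<close> has a smaller entry in the row above and so
    exceeds the minimum of that row; at the ends, \<open>i\<close> and \<open>b\<close> bound all
    entries of \<open>V\<close>.\<close>
  have d_Suc: "d k < d (Suc k)" if "k \<le> L" for k
  proof (cases k)
    case 0
    then show ?thesis using d0 dL ib d(1)[of 0] inV(1)[of "d (Suc 0)" 0] by (cases L) auto
  next
    case (Suc m)
    show ?thesis
    proof (cases "k = L")
      case True
      then show ?thesis using d(1)[of m] inV(1)[of "d k" m] dL Suc by simp
    next
      case False
      then have "d (Suc k) \<in> V (Suc m)" using d(1)[of k] that Suc by simp
      then obtain y where "y \<in> V m" "y < d (Suc k)" using richE[OF V] by metis
      then show ?thesis using d(2)[of m y] Suc that by simp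
    qed
  qed
  have d_mono: "d k \<le> d l" if "k \<le> l" "l \<le> Suc L" for k l
    using that
  proof (induction l rule: dec_induct)
    case (step l)
    then show ?case using d_Suc[of l] by simp
  qed simp
  have d_in: "i \<le> d k" "d k \<le> b" if "k \<le> Suc L" for k
    using d_mono[of 0 k] d_mono[of k "Suc L"] that d0 dL by simp_all
  \<comment> \<open>Later case splits use these three origins of an entry: from \<open>U\<close>,
    unmoved from \<open>V\<close>, or on the column \<open>d\<close>.\<close>
  have cases: "(x \<in> U k \<and> x < i) \<or> (x \<in> V k \<and> k < L \<and> d (Suc k) < x \<and> x < b) \<or> (x = d k \<and> k \<le> Suc L)"
    if "x \<in> R k" for x k
    using that inU[of x k] inV[of x k] d(2)[of k x] unfolding R by (auto split: if_splits)
  show "(\<Union>k. R k) = {a..<Suc b}"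
  proof (intro set_eqI iffI)
    fix x assume "x \<in> (\<Union>k. R k)"
    then obtain k where "x \<in> R k" by blast
    then show "x \<in> {a..<Suc b}"
      using inU[of x k] inV(1)[of x k] d_in[of k] ib unfolding R by (auto split: if_splits)
  next
    fix x assume x: "x \<in> {a..<Suc b}"
    consider "x < i" | "x = i" | "x = b" | "i < x" "x < b" using x by force
    then show "x \<in> (\<Union>k. R k)"
    proof cases
      case 1
      then obtain k where "x \<in> U k" using x rich_Union[OF U, of x] by auto
      then show ?thesis unfolding R by blast
    next
      case 2
      then have "x \<in> R 0" unfolding R using d0 by simp
      then show ?thesis by blast
    next
      case 3
      then have "x \<in> R (Suc L)" unfolding R using dL by simp
      then show ?thesis by blast
    next
      case 4
      then obtain k where k: "x \<in> V k" using rich_Union[OF V, of x] by auto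
      show ?thesis
      proof (cases "x = d (Suc k)")
        case True
        then have "x \<in> R (Suc k)" unfolding R using inV(2)[OF k] by simp
        then show ?thesis by blast
      next
        case False
        then have "x \<in> R k" unfolding R using k by simp
        then show ?thesis by blast
      qed
    qed
  qed
  show "k = l" if "x \<in> R k" "x \<in> R l" for k l x
  proof -
    have strict: "k = l" if "d k = d l" "k \<le> Suc L" "l \<le> Suc L" for k l
      using that d_mono[of "Suc k" l] d_mono[of "Suc l" k] d_Suc[of k] d_Suc[of l]
      by (cases k l rule: linorder_cases) auto
    have dV: "k = Suc l" if k: "d k \<in> V l" "k \<le> Suc L" for k l
    proof -
      have "k \<noteq> 0" "k \<noteq> Suc L" using k inV(1)[of "d k" l] d0 dL by (auto intro: gr0I)
      then obtain m where "k = Suc m" "m < L" using k(2) by (cases k) auto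
      then show ?thesis using d(1)[of m] k(1) rich_disjoint[OF V] by auto
    qed
    have Vd: False if "x \<in> V k" "d (Suc k) < x" "x = d l" "l \<le> Suc L" for k l x
      using dV[of l k] that by simp
    note ck = cases[OF that(1)] and cl = cases[OF that(2)]
    consider "x \<in> U k" "x < i" | "x \<in> V k" "d (Suc k) < x" | "x = d k" "k \<le> Suc L"
      using ck by blast
    then show ?thesis
    proof cases
      case 1
      then have "x \<in> U l"
        using cl inV(1)[of x l] d_in(1)[of l] by auto
      then show ?thesis using rich_disjoint[OF U] 1(1) by metis
    next
      case 2
      then have "x \<in> V l"
        using cl inV(1)[of x k] Vd[of x k l] by auto
      then show ?thesis using rich_disjoint[OF V] 2(1) by metis
    next
      case 3
      then have "x = d l" "l \<le> Suc L"
        using cl Vd[of x l k] d_in(1)[of k] by auto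
      then show ?thesis using strict 3 by metis
    qed
  qed
  fix k j assume "j \<in> R (Suc k)"
  then consider "j \<in> U (Suc k)" "j < i"
    | "j \<in> V (Suc k)" "Suc k < L" "d (Suc (Suc k)) < j" | "j = d (Suc k)" "k \<le> L"
    using cases by fastforce
  then show "\<exists>y\<in>R k. y < j \<and> (\<forall>l>k. \<forall>x\<in>R l. x < j \<longrightarrow> x < y)"
  proof cases
    case 1
    obtain y where y: "y \<in> U k" "y < j" "\<And>l x. k < l \<Longrightarrow> x \<in> U l \<Longrightarrow> x < j \<Longrightarrow> x < y"
      using richE[OF U 1(1)] by metis
    have "x < y" if "k < l" "x \<in> R l" "x < j" for l x
      using cases[OF that(2)] y(3)[OF that(1) _ that(3)] d_in[of l] inV(1)[of x l] 1(2) that(3) by auto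
    moreover have "y \<in> R k" using y(1) unfolding R by blast
    ultimately show ?thesis using y(2) by blast
  next
    case 2
    obtain y where y: "y \<in> V k" "y < j" "\<And>l x. k < l \<Longrightarrow> x \<in> V l \<Longrightarrow> x < j \<Longrightarrow> x < y"
      using richE[OF V 2(1)] by metis
    \<comment> \<open>The witness has to survive the removal of the minimum of row \<open>k\<close>.
      It does, since it exceeds \<open>d (Suc (Suc k))\<close>, an entry of row \<open>Suc k\<close>
      of \<open>V\<close> that is smaller than \<open>j\<close>.\<close>
    have gt: "d (Suc k) < y"
    proof -
      have "d (Suc (Suc k)) < y"
        using y(3)[of "Suc k" "d (Suc (Suc k))"] d(1)[of "Suc k"] 2 by simp
      then show ?thesis using d_Suc[of "Suc k"] 2 by simp
    qed
    have "x < y" if "k < l" "x \<in> R l" "x < j" for l x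
    proof -
      note cl = cases[OF that(2)] and kl = that
      consider "x < i" | "x \<in> V l" | "x = d l" "l \<le> Suc L" using cl by blast
      then show ?thesis
      proof cases
        case 1
        then show ?thesis using inV(1)[OF y(1)] by simp
      next
        case 2
        then show ?thesis using y(3) kl by blast
      next
        case 3
        have j: "j < b" using inV(1) \<open>j \<in> V (Suc k)\<close> by blast
        show ?thesis
        \<comment> \<open>\<open>d l\<close> comes from row \<open>l - 1\<close> of
          \<open>V\<close>. For \<open>l = Suc k\<close> this is row \<open>k\<close> itself, about
          which the witness property of \<open>y\<close> says nothing; there \<open>gt\<close>
          decides.\<close>
        proof (cases "l = Suc k")
          case True
          then show ?thesis using gt 3 by simp
        next
          case False
          have "l \<noteq> Suc L" using 3 dL j kl(3) by auto
          then obtain m where m: "l = Suc m" "k < m" "m < L"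
            using False 3(2) kl(1) by (cases l) auto
          then have "x \<in> V m" using d(1)[of m] 3 by simp
          then show ?thesis using y(3) m kl(3) by blast
        qed
      qed
    qed
    moreover have "y \<in> R k" using y(1) gt unfolding R by simp
    ultimately show ?thesis using y(2) by blast
  next
    case 3
    have "x < d k" if "k < l" "x \<in> R l" "x < j" for l x
    proof -
      note cl = cases[OF that(2)] and kl = that
      consider "x < i" | "d (Suc l) < x" "l < L" | "x = d l" "l \<le> Suc L" using cl by blast
      then show ?thesis
      proof cases
        case 1
        then show ?thesis using d_in[of k] 3(2) by simp
      next
        case 2
        then show ?thesis using d_mono[of "Suc k" "Suc l"] kl 3 by simp
      next
        case 3
        then show ?thesis using d_mono[of "Suc k" l] kl \<open>j = d (Suc k)\<close> by simp
      qed
    qed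
    moreover have "d k \<in> R k" unfolding R using 3(2) by simp
    ultimately show ?thesis using d_Suc[OF 3(2)] 3(1) by blast
  qed
qed

text \<open>This is the reverse bumping path that starts at the entry \<open>j\<close> of row \<open>r\<close>.\<close>

lemma rich_descending_path:
  assumes "rich S R" "finite S" "j \<in> R r"
  obtains d where "d r = j"
    "\<And>k. k \<le> r \<Longrightarrow> d k \<in> R k" "\<And>k. k < r \<Longrightarrow> d k < d (Suc k)"
    "\<And>k l x. k < r \<Longrightarrow> k < l \<Longrightarrow> x \<in> R l \<Longrightarrow> x < d (Suc k) \<Longrightarrow> x < d k"
    "\<And>k x. k < r \<Longrightarrow> x \<in> R k \<Longrightarrow> x < d (Suc k) \<Longrightarrow> x \<le> d k"
  using assms(3)
proof (induction r arbitrary: j thesis)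
  case 0
  show ?case by (rule 0(1)[of "\<lambda>_. j"]) (use 0(2) in auto)
next
  case (Suc r)
  obtain y where y: "y \<in> R r" "y < j" "\<And>l x. r < l \<Longrightarrow> x \<in> R l \<Longrightarrow> x < j \<Longrightarrow> x < y"
    using richE[OF assms(1) Suc.prems(2)] by metis
  let ?M = "{x \<in> R r. x < j}"
  have fin: "finite ?M" by (rule finite_subset[of _ "{..<j}"]) auto
  define m where "m = Max ?M"
  have "m \<in> ?M" unfolding m_def using fin y by (intro Max_in) auto
  then have m: "m \<in> R r" "m < j" by simp_all
  have ub: "x \<le> m" if "x \<in> R r" "x < j" for x
    unfolding m_def using that fin by (intro Max_ge) auto
  \<comment> \<open>Since \<open>m\<close> is at least the Richardson witness, it exceeds whatever
    that witness exceeds.\<close>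
  have le: "y \<le> m" using ub y by simp
  obtain d where d: "d r = m"
    "\<And>k. k \<le> r \<Longrightarrow> d k \<in> R k" "\<And>k. k < r \<Longrightarrow> d k < d (Suc k)"
    "\<And>k l x. k < r \<Longrightarrow> k < l \<Longrightarrow> x \<in> R l \<Longrightarrow> x < d (Suc k) \<Longrightarrow> x < d k"
    "\<And>k x. k < r \<Longrightarrow> x \<in> R k \<Longrightarrow> x < d (Suc k) \<Longrightarrow> x \<le> d k"
    using Suc.IH[OF _ m(1)] by blast
  show ?case
  proof (rule Suc.prems(1)[of "d(Suc r := j)"])
    show "(d(Suc r := j)) k \<in> R k" if "k \<le> Suc r" for k
      using that d(2) Suc.prems(2) by (cases "k = Suc r") auto
    show "(d(Suc r := j)) k < (d(Suc r := j)) (Suc k)" if "k < Suc r" for k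
      using that d(1,3) m(2) by (cases "k = r") auto
    show "x < (d(Suc r := j)) k" if "k < Suc r" "k < l" "x \<in> R l" "x < (d(Suc r := j)) (Suc k)" for k l x
      using that d(1) d(4)[of k l x] y(3)[of l x] le by (cases "k = r") auto
    show "x \<le> (d(Suc r := j)) k" if "k < Suc r" "x \<in> R k" "x < (d(Suc r := j)) (Suc k)" for k x
      using that d(1) d(5)[of k x] ub[of x] by (cases "k = r") auto
  qed simp
qed

text \<open>Inverse of \<open>rich_compose\<close>. The path \<open>d\<close> climbs from
  \<open>b\<close> to \<open>i = d 0\<close>; \<open>U\<close> collects the entries smaller than
  \<open>i\<close>, and \<open>V\<close> those to the right of the path, with the inner path entries
  raised by one row to become row minima.\<close>

lemma rich_decompose:
  assumes R: "rich {a..<Suc b} R" and b: "b \<in> R (Suc L)"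
  obtains i U V d where "a \<le> i" "i < b" "rich {a..<i} U" "rich {Suc i..<b} V"
    "\<And>k. V k = {} \<longleftrightarrow> L \<le> k" "d 0 = i" "d (Suc L) = b"
    "\<And>k. k < L \<Longrightarrow> d (Suc k) \<in> V k" "\<And>k x. k < L \<Longrightarrow> x \<in> V k \<Longrightarrow> d (Suc k) \<le> x"
    "\<And>k. R k = U k \<union> (V k - {d (Suc k)}) \<union> (if k \<le> Suc L then {d k} else {})"
proof -
  obtain d where d: "d (Suc L) = b"
    "\<And>k. k \<le> Suc L \<Longrightarrow> d k \<in> R k" "\<And>k. k \<le> L \<Longrightarrow> d k < d (Suc k)"
    "\<And>k l x. k \<le> L \<Longrightarrow> k < l \<Longrightarrow> x \<in> R l \<Longrightarrow> x < d (Suc k) \<Longrightarrow> x < d k"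
    "\<And>k x. k \<le> L \<Longrightarrow> x \<in> R k \<Longrightarrow> x < d (Suc k) \<Longrightarrow> x \<le> d k"
    using rich_descending_path[OF R _ b] by (auto simp: less_Suc_eq_le)
  have inR: "a \<le> x" "x \<le> b" if "x \<in> R k" for x k
    using rich_Union[OF R, of x] that by auto
  note disj = rich_disjoint[OF R]
  have d_mono: "d k \<le> d l" if "k \<le> l" "l \<le> Suc L" for k l
    using that
  proof (induction l rule: dec_induct)
    case (step l)
    then show ?case using d(3)[of l] by simp
  qed simp
  define i where "i = d 0"
  have ia: "a \<le> i" unfolding i_def using inR d(2)[of 0] by simp
  have ib: "i < b" unfolding i_def using d(3)[of 0] d_mono[of "Suc 0" "Suc L"] d(1) by simp
  \<comment> \<open>Going up the path from row \<open>k\<close>, the fourth property of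
    \<open>d\<close> keeps \<open>x\<close> smaller than every path entry, until
    \<open>d 0 = i\<close> is reached.\<close>
  have low: "x < i" if "k \<le> l" "k \<le> Suc L" "x \<in> R l" "x < d k" for k l x
    using that
  proof (induction k)
    case 0
    then show ?case by (simp add: i_def)
  next
    case (Suc k)
    then show ?case using d(4)[of k l x] by simp
  qed
  have cases: "x < i \<or> (k \<le> Suc L \<and> x = d k) \<or> (k < L \<and> d (Suc k) < x \<and> x < b)"
    if x: "x \<in> R k" for x k
  proof (cases "k \<le> L")
    \<comment> \<open>In the rows after \<open>L\<close> no entry exceeds
      \<open>b = d (Suc L)\<close>; apart from \<open>b\<close> itself they contain only entries
      smaller than \<open>i\<close>.\<close>
    case False
    then have "x = d (Suc L) \<and> k = Suc L \<or> x < d (Suc L)"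
      using inR(2)[OF x] d(1) disj[OF b, of k] x by (metis le_neq_implies_less)
    then show ?thesis using low[of "Suc L" k x] x False by auto
  next
    case True
    consider "x < d k" | "x = d k" | "d k < x" by linarith
    then show ?thesis
    proof cases
      case 1
      then show ?thesis using low[of k k x] x True by simp
    next
      case 2
      then show ?thesis using True by simp
    next
      case 3
      have "x \<noteq> d (Suc k)"
        using disj[of x k "Suc k"] d(2)[of "Suc k"] x True by auto
      then have gt: "d (Suc k) < x"
        using d(5)[OF True x] 3 by linarith
      have "x \<noteq> b" using disj[OF b, of k] x True by auto
      then have "x < b" using inR(2)[OF x] by simp
      \<comment> \<open>An entry of row \<open>L\<close> beyond \<open>d (Suc L)\<close> would
        exceed the maximum \<open>b\<close>. This is why \<open>V\<close> has only \<open>L\<close>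
        rows.\<close>
      moreover have "k \<noteq> L" using gt d(1) calculation by auto
      ultimately show ?thesis using gt True by simp
    qed
  qed
  define U where "U k = {x \<in> R k. x < i}" for k
  \<comment> \<open>No entry of row \<open>k\<close> lies strictly between \<open>d k\<close> and
    \<open>d (Suc k)\<close>, because the path always takes the largest possible entry; so nothing
    is lost between \<open>U\<close>, the path and \<open>V\<close>.\<close>
  define V where "V k = (if k < L then insert (d (Suc k)) {x \<in> R k. d (Suc k) < x} else {})" for k
  have richU: "rich {a..<i} U"
  proof -
    have "{x \<in> {a..<Suc b}. x < i} = {a..<i}" using ib by auto
    then show ?thesis using rich_restrict[OF R, of i] unfolding U_def by simp
  qed
  have richV: "rich {Suc i..<b} V"
  proof (rule richI)
    have lt_b: "d (Suc k) < b" "i < d (Suc k)" if "k < L" for k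
      using d_mono[of "Suc (Suc k)" "Suc L"] d(3)[of "Suc k"] d(1) that
        d_mono[of "Suc 0" "Suc k"] d(3)[of 0] i_def by simp_all
    show "(\<Union>k. V k) = {Suc i..<b}"
    proof (intro set_eqI iffI)
      fix x assume "x \<in> (\<Union>k. V k)"
      then obtain k where k: "x \<in> V k" by blast
      then have kL: "k < L" by (auto simp: V_def split: if_splits)
      have "x = d (Suc k) \<or> x \<in> R k \<and> d (Suc k) < x"
        using k kL by (simp add: V_def)
      then show "x \<in> {Suc i..<b}"
      proof
        assume "x = d (Suc k)"
        then show ?thesis using lt_b[OF kL] by simp
      next
        assume x: "x \<in> R k \<and> d (Suc k) < x"
        then have "x \<noteq> b" using disj[OF b, of k] kL by auto
        then show ?thesis using x lt_b[OF kL] inR(2)[of x k] by simp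
      qed
    next
      fix x assume x: "x \<in> {Suc i..<b}"
      then have "\<exists>k. x \<in> R k" using rich_Union[OF R, of x] ia by simp
      then obtain k where k: "x \<in> R k" by blast
      have "(k \<le> Suc L \<and> x = d k) \<or> (k < L \<and> d (Suc k) < x)"
        using cases[OF k] x by auto
      then show "x \<in> (\<Union>k. V k)"
      proof
        assume dk: "k \<le> Suc L \<and> x = d k"
        then have "k \<noteq> 0" "k \<noteq> Suc L" using x i_def d(1) by (auto intro: gr0I)
        then obtain m where "k = Suc m" "m < L" using dk by (cases k) auto
        then have "x \<in> V m" using dk by (simp add: V_def)
        then show ?thesis by blast
      next
        assume "k < L \<and> d (Suc k) < x"
        then have "x \<in> V k" using k by (simp add: V_def)
        then show ?thesis by blast
      qed
    qed
    have V_cases: "k < L \<and> (x = d (Suc k) \<and> x \<in> R (Suc k) \<or> x \<in> R k \<and> d (Suc k) < x)"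
      if "x \<in> V k" for x k
      using that d(2)[of "Suc k"] by (auto simp: V_def split: if_splits)
    show "k = l" if "x \<in> V k" "x \<in> V l" for k l x
    proof -
      have F: False if "x = d (Suc k)" "x \<in> R (Suc k)" "x \<in> R l" "d (Suc l) < x" "l < L" for k l
        using that disj[of x "Suc k" l] d_mono[of l "Suc l"] by auto
      show ?thesis
        using V_cases[OF that(1)] V_cases[OF that(2)] F[of k l] F[of l k] disj[of x] by blast
    qed
    fix k j assume j: "j \<in> V (Suc k)"
    note jc = V_cases[OF j]
    show "\<exists>y\<in>V k. y < j \<and> (\<forall>l>k. \<forall>x\<in>V l. x < j \<longrightarrow> x < y)"
    \<comment> \<open>A raised path entry has the witness \<open>d (Suc k)\<close>, which has
      nothing to exceed: in rows \<open>l > k\<close> all entries of \<open>V\<close> are at least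
      \<open>d (Suc l)\<close>, hence at least \<open>j\<close>.\<close>
    proof (cases "j = d (Suc (Suc k))")
      case True
      have "False" if "k < l" "x \<in> V l" "x < j" for l x
        using V_cases[OF that(2)] d_mono[of "Suc (Suc k)" "Suc l"] that True by auto
      moreover have "d (Suc k) \<in> V k" using jc by (simp add: V_def)
      moreover have "d (Suc k) < j" using True d(3)[of "Suc k"] jc by simp
      ultimately show ?thesis by blast
    next
      case False
      then have jR: "j \<in> R (Suc k)" "d (Suc (Suc k)) < j" using jc by auto
      obtain y where y: "y \<in> R k" "y < j" "\<And>l x. k < l \<Longrightarrow> x \<in> R l \<Longrightarrow> x < j \<Longrightarrow> x < y"
        using richE[OF R jR(1)] by metis
      have "d (Suc k) < y"
        using y(3)[of "Suc k" "d (Suc k)"] d(2)[of "Suc k"] d(3)[of "Suc k"] jR(2) jc by simp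
      then have "y \<in> V k" using y(1) jc by (simp add: V_def)
      \<comment> \<open>An entry of row \<open>l\<close> of \<open>V\<close> sits in row
        \<open>l\<close> of \<open>R\<close> or, if it was raised, in row \<open>Suc l\<close>; both
        come after row \<open>k\<close>.\<close>
      moreover have "x < y" if "k < l" "x \<in> V l" "x < j" for l x
        using V_cases[OF that(2)] y(3)[of l x] y(3)[of "Suc l" x] that by auto
      ultimately show ?thesis using y(2) by blast
    qed
  qed
  have R_eq: "R k = U k \<union> (V k - {d (Suc k)}) \<union> (if k \<le> Suc L then {d k} else {})" for k
  proof (intro set_eqI iffI)
    fix x assume x: "x \<in> R k"
    show "x \<in> U k \<union> (V k - {d (Suc k)}) \<union> (if k \<le> Suc L then {d k} else {})"
      using cases[OF x] x by (auto simp: U_def V_def)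
  next
    fix x assume "x \<in> U k \<union> (V k - {d (Suc k)}) \<union> (if k \<le> Suc L then {d k} else {})"
    then show "x \<in> R k"
      using d(2)[of k] by (auto simp: U_def V_def split: if_splits)
  qed
  have V_empty: "V k = {} \<longleftrightarrow> L \<le> k" for k
    by (simp add: V_def)
  have V_min: "d (Suc k) \<in> V k" "x \<in> V k \<Longrightarrow> d (Suc k) \<le> x" if "k < L" for k x
    using that by (auto simp: V_def)
  show ?thesis
    by (rule that[OF ia ib richU richV V_empty i_def[symmetric] d(1) V_min R_eq])
qed

section \<open>Insertion\<close>

lemma juxtapose_Nil_right [simp]: "juxtapose U [] = U"
  by (cases U) simp_all

lemma row_insert_set: "row_insert x r = (r', ob) \<Longrightarrow> set r' \<union> set_option ob = insert x (set r)"
  by (induction x r arbitrary: r' ob rule: row_insert.induct) (fastforce split: if_splits prod.splits)+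

lemma concat_tableau_insert: "set (concat (tableau_insert x T)) = insert x (set (concat T))"
proof (induction x T rule: tableau_insert.induct)
  case (2 x r rs)
  obtain r' ob where r': "row_insert x r = (r', ob)" by force
  show ?case
    using row_insert_set[OF r'] "2.IH"[OF r'[symmetric]] r' by (cases ob) auto
qed simp

lemma concat_fold_insert: "set (concat (fold tableau_insert w T)) = set w \<union> set (concat T)"
  by (induction w arbitrary: T) (auto simp del: set_concat simp: concat_tableau_insert)

lemma row_insert_append:
  "\<forall>y\<in>set r. y < x \<Longrightarrow> row_insert x (r @ s) = (r @ fst (row_insert x s), snd (row_insert x s))"
  by (induction r) (auto simp: case_prod_beta)

lemma row_insert_large: "\<forall>y\<in>set r. y < x \<Longrightarrow> row_insert x r = (r @ [x], None)"
  using row_insert_append[of r x "[]"] by simp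

text \<open>\<open>x\<close> passes over the entries of \<open>U\<close>, and what it bumps is an
  entry of \<open>W\<close>, which again exceeds all of \<open>U\<close>. Once the rows of
  \<open>W\<close> are exhausted, the entry is appended to the next row of \<open>U\<close>, if
  there is one.\<close>

lemma tableau_insert_juxtapose:
  assumes "\<forall>y\<in>set (concat U). y < x" "\<forall>y\<in>set (concat U). \<forall>z\<in>set (concat W). y < z"
  shows "tableau_insert x (juxtapose U W) = juxtapose U (tableau_insert x W)"
  using assms
proof (induction U W arbitrary: x rule: juxtapose.induct)
  case (2 r U)
  then show ?case by (simp add: row_insert_large)
next
  case (3 r U s W)
  obtain s' ob where s': "row_insert x s = (s', ob)" by force
  have ins: "row_insert x (r @ s) = (r @ s', ob)"
    using "3.prems" by (subst row_insert_append) (auto simp: s')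
  show ?case
  proof (cases ob)
    case None
    then show ?thesis by (simp add: ins s')
  next
    case (Some z)
    then have "z \<in> insert x (set s)" using row_insert_set[OF s'] by auto
    then have "\<forall>y\<in>set (concat U). y < z" using "3.prems" by auto
    then show ?thesis using "3.IH"[of z] "3.prems" Some by (simp add: ins s')
  qed
qed simp

lemma fold_insert_juxtapose:
  assumes "\<forall>y\<in>set (concat U). \<forall>z\<in>set w \<union> set (concat W). y < z"
  shows "fold tableau_insert w (juxtapose U W) = juxtapose U (fold tableau_insert w W)"
  using assms
proof (induction w arbitrary: W)
  case (Cons x w)
  have "tableau_insert x (juxtapose U W) = juxtapose U (tableau_insert x W)"
    using Cons.prems by (intro tableau_insert_juxtapose) auto
  moreover have "\<forall>y\<in>set (concat U). \<forall>z\<in>set w \<union> set (concat (tableau_insert x W)). y < z"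
    using Cons.prems unfolding concat_tableau_insert by auto
  ultimately show ?case using Cons.IH by simp
qed simp

text \<open>The row \<open>[b]\<close> stays at the bottom: an entry that would open a new row below
  \<open>W\<close> bumps \<open>b\<close> instead, and \<open>b\<close> opens the next row.\<close>

lemma tableau_insert_bottom:
  assumes "x < b" "\<forall>y\<in>set (concat W). y < b"
  shows "tableau_insert x (W @ [[b]]) = tableau_insert x W @ [[b]]"
  using assms
proof (induction x W rule: tableau_insert.induct)
  case (2 x r rs)
  obtain r' ob where r': "row_insert x r = (r', ob)" by force
  show ?case
  proof (cases ob)
    case (Some z)
    then have "z \<in> insert x (set r)" using row_insert_set[OF r'] by auto
    then have "z < b" using "2.prems" by auto
    then show ?thesis using "2.IH"[OF r'[symmetric] Some] "2.prems" by (simp add: r' Some)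
  qed (simp add: r')
qed simp

lemma fold_insert_bottom:
  assumes "\<forall>y\<in>set w \<union> set (concat W). y < b"
  shows "fold tableau_insert w (W @ [[b]]) = fold tableau_insert w W @ [[b]]"
  using assms
proof (induction w arbitrary: W)
  case (Cons x w)
  have "tableau_insert x (W @ [[b]]) = tableau_insert x W @ [[b]]"
    using Cons.prems by (intro tableau_insert_bottom) auto
  moreover have "\<forall>y\<in>set w \<union> set (concat (tableau_insert x W)). y < b"
    using Cons.prems unfolding concat_tableau_insert by auto
  ultimately show ?case using Cons.IH by simp
qed simp

text \<open>\<open>x\<close> bumps the head of the first row; as the first column increases, each
  bumped head is smaller than the head of the next row and bumps it in turn.\<close>

lemma tableau_insert_small:
  assumes "\<forall>r\<in>set W. r \<noteq> []" "sorted_wrt (<) (x # map hd W)"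
  shows "tableau_insert x W = push_column x W"
  using assms
proof (induction x W rule: push_column.induct)
  case (2 x s W)
  obtain y ys where s: "s = y # ys" using "2.prems"(1) by (cases s) auto
  show ?case using "2.IH" "2.prems" unfolding s by simp
qed simp

lemma row_juxtapose: "row (juxtapose U W) k = row U k \<union> row W k"
proof (induction U W arbitrary: k rule: juxtapose.induct)
  case (3 r U s W)
  then show ?case by (simp add: row_Cons split: nat.split)
qed simp_all

text \<open>With distinct entries, dropping the head of the list removes it from the row set. The
  list \<open>x # map hd W\<close> is the first column after the shift.\<close>

lemma row_push_column:
  assumes "\<forall>r\<in>set W. r \<noteq> [] \<and> distinct r"
  shows "row (push_column x W) k =
    (row W k - (if k < length W then {hd (W ! k)} else {})) \<union>
    (if k \<le> length W then {(x # map hd W) ! k} else {})"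
  using assms
proof (induction x W arbitrary: k rule: push_column.induct)
  case (1 x)
  then show ?case by (simp add: row_def)
next
  case (2 x s W)
  obtain y ys where s: "s = y # ys" using "2.prems" by (cases s) auto
  show ?case
  proof (cases k)
    case 0
    then show ?thesis using "2.prems" by (simp add: row_Cons s)
  next
    case (Suc m)
    then show ?thesis using "2.IH"[of m] "2.prems" by (simp add: row_Cons)
  qed
qed

lemma juxtapose_row_sorted:
  assumes "row_sorted U" "row_sorted W" "\<forall>y\<in>set (concat U). \<forall>z\<in>set (concat W). y < z"
  shows "row_sorted (juxtapose U W)"
  using assms
proof (induction U W rule: juxtapose.induct)
  case (3 r U s W)
  have "row_sorted (juxtapose U W)"
    using "3.prems" by (intro "3.IH") (simp_all add: row_sorted_def)
  moreover have "r \<noteq> []" "sorted_wrt (<) (r @ s)"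
    using "3.prems" by (simp_all add: row_sorted_def sorted_wrt_append)
  ultimately show ?case by (simp add: row_sorted_def)
qed simp_all

lemma push_column_row_sorted:
  assumes "row_sorted W" "sorted_wrt (<) (x # map hd W)"
  shows "row_sorted (push_column x W)"
  using assms
proof (induction x W rule: push_column.induct)
  case (2 x s W)
  obtain y ys where s: "s = y # ys" using "2.prems"(1) by (cases s) (auto simp: row_sorted_def)
  have "row_sorted (push_column y W)" "row_sorted W"
    using "2.IH" "2.prems" unfolding s row_sorted_def by simp_all
  moreover have "sorted_wrt (<) (x # ys)"
    using "2.prems" unfolding s row_sorted_def by auto
  ultimately show ?case unfolding s row_sorted_def by simp
qed (simp add: row_sorted_def)

lemma hd_le_sorted: "sorted_wrt (<) (r :: nat list) \<Longrightarrow> x \<in> set r \<Longrightarrow> hd r \<le> x"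
  by (cases r) auto

section \<open>Insertion tableaux of words extended by an arc or a fixed point\<close>

text \<open>Insertion counterpart of \<open>rich_compose\<close>, with \<open>heads\<close> in place
  of \<open>d\<close>: \<open>b\<close> starts a tableau to the right of that of \<open>u\<close>,
  the letters of \<open>v\<close> are inserted above \<open>b\<close>, and the final
  \<open>i\<close> pushes the first column down. For \<open>k > length (insertion_tableau v)\<close>
  the index in \<open>heads ! Suc k\<close> is out of range, but then the row is empty.\<close>

lemma insertion_tableau_arc:
  assumes U: "row_sorted (insertion_tableau u)" and V: "row_sorted (insertion_tableau v)"
    and rU: "rich {a..<i} (row (insertion_tableau u))"
    and rV: "rich {Suc i..<b} (row (insertion_tableau v))"
    and ib: "a \<le> i" "i < b"
  defines "T \<equiv> insertion_tableau (u @ [b] @ v @ [i])"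
  defines "heads \<equiv> i # map hd (insertion_tableau v) @ [b]"
  shows "row_sorted T"
    and "\<And>k. row T k = row (insertion_tableau u) k \<union>
      (row (insertion_tableau v) k - {heads ! Suc k}) \<union>
      (if k \<le> Suc (length (insertion_tableau v)) then {heads ! k} else {})"
    and "\<And>k x. x \<in> row (insertion_tableau v) k \<Longrightarrow> heads ! Suc k \<le> x"
    and "\<And>k. k < length (insertion_tableau v) \<Longrightarrow> heads ! Suc k \<in> row (insertion_tableau v) k"
proof -
  define tu tv where "tu = insertion_tableau u" and "tv = insertion_tableau v"
  note [simp] = tu_def[symmetric] tv_def[symmetric]
  have setu: "set (concat tu) = {a..<i}" "set u = {a..<i}"
    using rU concat_fold_insert[of u "[]"] unfolding rich_def Union_row insertion_tableau_def tu_def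
    by simp_all
  have setv: "set (concat tv) = {Suc i..<b}" "set v = {Suc i..<b}"
    using rV concat_fold_insert[of v "[]"] unfolding rich_def Union_row insertion_tableau_def tv_def
    by simp_all
  show hd_in: "heads ! Suc k \<in> row (insertion_tableau v) k" if "k < length (insertion_tableau v)" for k
    using that V by (simp add: heads_def nth_append row_def row_sorted_def)
  show hd_le: "heads ! Suc k \<le> x" if "x \<in> row (insertion_tableau v) k" for k x
    using that V hd_le_sorted[of "tv ! k" x]
    by (auto simp: heads_def nth_append row_def row_sorted_def split: if_splits)
  have in_tv: "i < x \<and> x < b" if "x \<in> row tv k" for x k
    using rich_Union[OF rV, of x] that by auto
  \<comment> \<open>By the Richardson condition each head in the tableau of \<open>v\<close> has a
    smaller entry in the row above; \<open>i\<close> and \<open>b\<close> bound all entries of that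
    tableau.\<close>
  have "sorted_wrt (<) heads"
    unfolding sorted_wrt_iff_nth_Suc_transp[OF transp_on_less]
  proof (intro allI impI)
    fix k assume k: "Suc k < length heads"
    show "heads ! k < heads ! Suc k"
    proof (cases k)
      case 0
      then show ?thesis using ib in_tv hd_in[of 0]
        by (cases tv) (auto simp: heads_def)
    next
      case (Suc m)
      then have m: "m < length tv" using k by (simp add: heads_def)
      show ?thesis
      proof (cases "k < length tv")
        case True
        then have "heads ! Suc k \<in> row (insertion_tableau v) (Suc m)"
          using hd_in[of k] Suc by simp
        then obtain y where "y \<in> row (insertion_tableau v) m" "y < heads ! Suc k"
          using richE[OF rV] by metis
        then show ?thesis using hd_le[of y m] Suc by simp
      next
        case False
        then have "heads ! Suc k = b" using m Suc by (simp add: heads_def nth_append)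
        then show ?thesis using in_tv[of "heads ! k" m] hd_in[of m] m Suc by simp
      qed
    qed
  qed
  then have srt: "sorted_wrt (<) (i # map hd (tv @ [[b]]))"
    by (simp add: heads_def)
  have sortW: "row_sorted (tv @ [[b]])"
    using V by (simp add: row_sorted_def)
  let ?P = "push_column i (tv @ [[b]])"
  \<comment> \<open>After \<open>u\<close>, the current tableau is viewed as \<open>tu\<close> with
    an empty right-hand part, and the remaining letters act on that part alone.\<close>
  have "T = fold tableau_insert (b # v @ [i]) (juxtapose tu [])"
    by (cases tu) (simp_all add: T_def insertion_tableau_def flip: tu_def[unfolded insertion_tableau_def])
  also have "\<dots> = juxtapose tu (fold tableau_insert (b # v @ [i]) [])"
    using ib setv(2) setu(1) by (intro fold_insert_juxtapose) (auto simp del: set_concat)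
  \<comment> \<open>Inserting \<open>b\<close> alone gives \<open>[[b]]\<close>, written as
    \<open>[] @ [[b]]\<close> to match \<open>fold_insert_bottom\<close>.\<close>
  also have "fold tableau_insert (b # v @ [i]) [] = tableau_insert i (fold tableau_insert v ([] @ [[b]]))"
    by simp
  also have "\<dots> = tableau_insert i (tv @ [[b]])"
    using setv(2) by (subst fold_insert_bottom) (auto simp: tv_def insertion_tableau_def)
  also have "\<dots> = ?P"
    using sortW srt by (intro tableau_insert_small) (auto simp: row_sorted_def)
  finally have T: "T = juxtapose tu ?P" .
  have rowP: "row ?P k = (row tv k - {heads ! Suc k}) \<union> (if k \<le> Suc (length tv) then {heads ! k} else {})" for k
  proof -
    have "b \<notin> row tv k" using in_tv by blast
    then show ?thesis
      using sortW by (subst row_push_column)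
        (auto simp: row_sorted_def strict_sorted_iff heads_def row_def nth_append nth_Cons' split: if_splits)
  qed
  show "row T k = row (insertion_tableau u) k \<union>
      (row (insertion_tableau v) k - {heads ! Suc k}) \<union>
      (if k \<le> Suc (length (insertion_tableau v)) then {heads ! k} else {})" for k
    by (simp add: T row_juxtapose rowP Un_assoc)
  have "set (concat ?P) \<subseteq> {i..b}"
  proof
    fix x assume "x \<in> set (concat ?P)"
    then obtain k where "x \<in> row ?P k" unfolding Union_row[symmetric] by blast
    moreover have "heads ! k \<in> {i..b}" if "k \<le> Suc (length tv)"
    proof (cases k)
      case 0
      then show ?thesis using ib by (simp add: heads_def)
    next
      case (Suc m)
      then show ?thesis using that hd_in[of m] in_tv[of "heads ! k" m] ib
        by (cases "m < length tv") (auto simp: heads_def nth_append)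
    qed
    ultimately show "x \<in> {i..b}"
      using in_tv[of x k] by (auto simp: rowP split: if_splits)
  qed
  then show "row_sorted T"
    unfolding T using U sortW srt setu(1)
    by (intro juxtapose_row_sorted push_column_row_sorted) (auto simp del: set_concat)
qed

text \<open>Insertion counterpart of \<open>rich_append_max\<close>: a letter exceeding all entries
  bumps nothing, which is juxtaposition with \<open>[[b]]\<close>.\<close>

lemma insertion_tableau_append_max:
  assumes "row_sorted (insertion_tableau u)" "rich {a..<b} (row (insertion_tableau u))"
  shows "row_sorted (insertion_tableau (u @ [b]))"
    and "row (insertion_tableau (u @ [b])) =
      (row (insertion_tableau u))(0 := insert b (row (insertion_tableau u) 0))"
proof -
  define tu where "tu = insertion_tableau u"
  have lt: "\<forall>y\<in>set (concat tu). y < b"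
    using assms(2) unfolding rich_def Union_row tu_def by simp
  have "insertion_tableau (u @ [b]) = tableau_insert b tu"
    by (simp add: insertion_tableau_def tu_def)
  also have "\<dots> = juxtapose tu [[b]]"
    using tableau_insert_juxtapose[OF lt, of "[]"] by (cases tu) simp_all
  finally have T: "insertion_tableau (u @ [b]) = juxtapose tu [[b]]" .
  show "row_sorted (insertion_tableau (u @ [b]))"
    unfolding T using assms(1) lt
    by (intro juxtapose_row_sorted) (simp_all add: tu_def row_sorted_def)
  show "row (insertion_tableau (u @ [b])) =
      (row (insertion_tableau u))(0 := insert b (row (insertion_tableau u) 0))"
    by (rule ext) (simp add: T row_juxtapose row_def[of "[[b]]"] tu_def)
qed

section \<open>Noncrossing involutions\<close>

lemma nc_involutionD:
  assumes "nc_involution a b f" "a \<le> x" "x < b"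
  shows "a \<le> f x" "f x < b" "f (f x) = x"
  using assms unfolding nc_involution_def by auto

lemma nc_involution_nesting:
  assumes "nc_involution a b f" "a \<le> x" "x < y" "y < f x" "x < b"
  shows "f y \<le> f x"
  using assms nc_involutionD(2)[OF assms(1,2,5)] unfolding nc_involution_def by auto

lemma nc_involution_remove_fixed:
  assumes f: "nc_involution a (Suc b) f" and "a \<le> b" "f b = b"
  shows "nc_involution a b f"
  unfolding nc_involution_def
proof (intro conjI ballI impI)
  fix x assume x: "x \<in> {a..<b}"
  have "f x \<noteq> b" using nc_involutionD(3)[OF f, of x] x assms(3) by auto
  then show "f x \<in> {a..<b}" "f (f x) = x"
    using nc_involutionD[OF f, of x] x by auto
  show "f y \<le> f x" if "y \<in> {a..<b}" "x < y \<and> y < f x" for y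
    using nc_involution_nesting[OF f, of x y] that x by auto
qed

text \<open>The arc from \<open>f b\<close> to \<open>b\<close> separates the points under it from
  those before it, since an arc between the two sides would cross it.\<close>

lemma nc_involution_arc:
  assumes f: "nc_involution a (Suc b) f" and "a \<le> b" "f b \<noteq> b"
  shows "a \<le> f b" "f b < b" "f (f b) = b"
    "nc_involution a (f b) f" "nc_involution (Suc (f b)) b f"
proof -
  define i where "i = f b"
  have i: "a \<le> i" "i < b" "f i = b"
    using nc_involutionD[OF f, of b] assms(2,3) by (auto simp: i_def)
  then show "a \<le> f b" "f b < b" "f (f b) = b" by (simp_all add: i_def)
  note D = nc_involutionD[OF f] and N = nc_involution_nesting[OF f]
  have ne: "f x \<noteq> i" "f x \<noteq> b" if "a \<le> x" "x < b" "x \<noteq> i" for x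
    using D(3)[of x] that i i_def by auto
  have left: "f x < i" if "a \<le> x" "x < i" for x
  proof (rule ccontr)
    assume "\<not> f x < i"
    then have "i < f x" using ne[of x] that i by simp
    \<comment> \<open>The point \<open>i\<close> lies under the arc \<open>(x, f x)\<close>, so
      \<open>b = f i \<le> f x\<close>; but \<open>f x = b\<close> is already excluded.\<close>
    then have "b \<le> f x" using N[of x i] that i by simp
    then show False using ne[of x] D(2)[of x] that i by simp
  qed
  have right: "i < f x \<and> f x < b" if "i < x" "x < b" for x
  proof -
    \<comment> \<open>Involutivity reduces this to \<open>left\<close>: otherwise \<open>f x\<close>
      would be a point left of \<open>i\<close> whose image \<open>x\<close> lies right of
      \<open>i\<close>.\<close>
    have "\<not> f x < i"
    proof
      assume "f x < i"
      then have "f (f x) < i" using left[of "f x"] D(1)[of x] that i by simp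
      moreover have "f (f x) = x" using D(3)[of x] that i by simp
      ultimately show False using that by simp
    qed
    then show ?thesis using ne[of x] D(2)[of x] that i by auto
  qed
  show "nc_involution a (f b) f"
    unfolding nc_involution_def i_def[symmetric]
  proof (intro conjI ballI impI)
    fix x assume x: "x \<in> {a..<i}"
    then show "f x \<in> {a..<i}" "f (f x) = x" using left[of x] D[of x] i by auto
    show "f y \<le> f x" if "y \<in> {a..<i}" "x < y \<and> y < f x" for y
      using N[of x y] that x i by simp
  qed
  show "nc_involution (Suc (f b)) b f"
    unfolding nc_involution_def i_def[symmetric]
  proof (intro conjI ballI impI)
    fix x assume x: "x \<in> {Suc i..<b}"
    then show "f x \<in> {Suc i..<b}" "f (f x) = x" using right[of x] D[of x] i by auto
    show "f y \<le> f x" if "y \<in> {Suc i..<b}" "x < y \<and> y < f x" for y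
      using N[of x y] that x i by simp
  qed
qed

text \<open>Nothing crosses the new arc \<open>(i, b)\<close>: the arcs of \<open>h\<close> lie
  under it, and those of \<open>g\<close> end before it begins.\<close>

lemma nc_involution_add_arc:
  assumes g: "nc_involution a i g" and h: "nc_involution (Suc i) b h" and ib: "a \<le> i" "i < b"
  defines "f \<equiv> \<lambda>x. if x < i then g x else if x = i then b else if x = b then i else h x"
  shows "nc_involution a (Suc b) f"
proof -
  have f: "f i = b" "f b = i" "\<And>x. x < i \<Longrightarrow> f x = g x" "\<And>x. i < x \<Longrightarrow> x < b \<Longrightarrow> f x = h x"
    using ib by (simp_all add: f_def)
  have cases: thesis if "x \<in> {a..<Suc b}"
    "a \<le> x \<Longrightarrow> x < i \<Longrightarrow> thesis" "x = i \<Longrightarrow> thesis" "x = b \<Longrightarrow> thesis"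
    "Suc i \<le> x \<Longrightarrow> x < b \<Longrightarrow> thesis" for x thesis
    using that by force
  show ?thesis
    unfolding nc_involution_def
  proof (intro conjI ballI impI)
    fix x assume x: "x \<in> {a..<Suc b}"
    show "f x \<in> {a..<Suc b}" "f (f x) = x"
      by (rule cases[OF x]; use f ib nc_involutionD[OF g, of x] nc_involutionD[OF h, of x] in simp)+
    show "f y \<le> f x" if y: "y \<in> {a..<Suc b}" and xy: "x < y \<and> y < f x" for y
    proof (rule cases[OF x])
      assume x: "a \<le> x" "x < i"
      then show ?thesis
        using nc_involutionD[OF g, of x] nc_involution_nesting[OF g, of x y] xy f(3)[of x] f(3)[of y] by simp
    next
      assume "x = i"
      then show ?thesis
        using nc_involutionD(2)[OF h, of y] xy f(1) f(4)[of y] by simp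
    next
      assume "x = b"
      then show ?thesis using y xy f ib by simp
    next
      assume x: "Suc i \<le> x" "x < b"
      then show ?thesis
        using nc_involutionD[OF h, of x] nc_involution_nesting[OF h, of x y] xy f(4)[of x] f(4)[of y] by simp
    qed
  qed
qed

lemma map_upt_arc:
  assumes "a \<le> i" "i < b" "f i = b" "f b = i"
  shows "map f [a..<Suc b] = map f [a..<i] @ [b] @ map f [Suc i..<b] @ [i]"
proof -
  have "[a..<b] = [a..<i] @ [i] @ [Suc i..<b]"
    using assms(1,2) upt_add_eq_append[of a i "b - i"] upt_conv_Cons[of i b] by simp
  then show ?thesis using assms by simp
qed

section \<open>The common recursion of the two sets of tableaux\<close>

text \<open>Induction on the right end with the left end arbitrary, because the part under the last
  arc starts at \<open>Suc (f c)\<close>.\<close>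

lemma rich_insertion_tableau:
  assumes "nc_involution a b f" "a \<le> b"
  defines "T \<equiv> insertion_tableau (map f [a..<b])"
  shows "row_sorted T \<and> rich {a..<b} (row T)"
  using assms(1,2) unfolding T_def
proof (induction b arbitrary: a rule: less_induct)
  case (less b)
  show ?case
  proof (cases "a = b")
    case True
    then show ?thesis by (simp add: insertion_tableau_def row_sorted_def rich_def)
  next
    case False
    then obtain c where c: "b = Suc c" "a \<le> c" using less.prems(2) by (cases b) auto
    note f = less.prems(1)[unfolded c(1)]
    show ?thesis
    proof (cases "f c = c")
      case True
      have IH: "row_sorted (insertion_tableau (map f [a..<c]))"
        "rich {a..<c} (row (insertion_tableau (map f [a..<c])))"
        using less.IH[of c a] nc_involution_remove_fixed[OF f c(2) True] c by simp_all
      have "map f [a..<b] = map f [a..<c] @ [c]"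
        using c True by simp
      then show ?thesis
        using insertion_tableau_append_max[OF IH] rich_append_max[OF IH(2) c(2)] c(1)
        by (simp del: fun_upd_apply)
    next
      case fc: False
      note arc = nc_involution_arc[OF f c(2) fc]
      let ?u = "map f [a..<f c]" and ?v = "map f [Suc (f c)..<c]"
      have U: "row_sorted (insertion_tableau ?u)" "rich {a..<f c} (row (insertion_tableau ?u))"
        using less.IH[OF _ arc(4)] arc(1,2) c(1) by simp_all
      have V: "row_sorted (insertion_tableau ?v)" "rich {Suc (f c)..<c} (row (insertion_tableau ?v))"
        using less.IH[OF _ arc(5)] arc(1,2) c(1) by simp_all
      note T = insertion_tableau_arc[OF U(1) V(1) U(2) V(2) arc(1,2)]
      \<comment> \<open>The function \<open>d\<close> of \<open>rich_compose\<close> is here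
        indexing into the list \<open>heads\<close> of \<open>insertion_tableau_arc\<close>.\<close>
      have "rich {a..<Suc c} (row (insertion_tableau (?u @ [c] @ ?v @ [f c])))"
        by (rule rich_compose[OF U(2) V(2) arc(1,2) row_eq_empty_iff[OF V(1)] _ _ T(4,3,2)])
          (simp_all add: nth_append)
      then show ?thesis
        using T(1) c(1) map_upt_arc[OF arc(1,2,3) refl] by simp
    qed
  qed
qed

text \<open>The recursion backwards: if the largest entry \<open>c\<close> is in row 0, the last
  point is made a fixed point; otherwise \<open>rich_decompose\<close> supplies the arc
  \<open>(i, c)\<close>. By \<open>row_sorted_eqI\<close> the resulting tableau is compared with
  \<open>T\<close> through row sets.\<close>

lemma rich_obtain_nc_involution:
  assumes "row_sorted T" "rich {a..<b} (row T)" "a \<le> b"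
  shows "\<exists>f. nc_involution a b f \<and> insertion_tableau (map f [a..<b]) = T"
  using assms
proof (induction b arbitrary: a T rule: less_induct)
  case (less b)
  show ?case
  proof (cases "a = b")
    case True
    then have "row T k = {}" for k
      using less.prems(2) by (auto simp: rich_def)
    then have "T = []"
      using row_eq_empty_iff[OF less.prems(1), of 0] by simp
    then show ?thesis using True by (auto simp: insertion_tableau_def nc_involution_def)
  next
    case False
    then obtain c where c: "b = Suc c" "a \<le> c" using less.prems(3) by (cases b) auto
    note R = less.prems(2)[unfolded c(1)]
    obtain m where m: "c \<in> row T m" using rich_Union[OF R, of c] c(2) by auto
    show ?thesis
    proof (cases m)
      case 0
      have "{x \<in> {a..<Suc c}. x < c} = {a..<c}" by auto
      then have rU: "rich {a..<c} (\<lambda>k. {x \<in> row T k. x < c})"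
        using rich_restrict[OF R, of c] by simp
      obtain U where U: "row_sorted U" "row U = (\<lambda>k. {x \<in> row T k. x < c})"
        using rich_list_tableau[OF rU] by auto
      obtain g where g: "nc_involution a c g" "insertion_tableau (map g [a..<c]) = U"
        using less.IH[of c U a] U rU c by auto
      let ?f = "g(c := c)"
      have "nc_involution a (Suc c) ?f"
        unfolding nc_involution_def
      proof (intro conjI ballI impI)
        fix x assume x: "x \<in> {a..<Suc c}"
        show "?f x \<in> {a..<Suc c}" "?f (?f x) = x"
          using nc_involutionD[OF g(1), of x] x c(2) by (auto simp: less_Suc_eq)
        show "?f y \<le> ?f x" if "y \<in> {a..<Suc c}" "x < y \<and> y < ?f x" for y
          using nc_involutionD[OF g(1), of x] nc_involution_nesting[OF g(1), of x y] that x
          by (auto simp: less_Suc_eq split: if_splits)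
      qed
      moreover have "insertion_tableau (map ?f [a..<Suc c]) = T"
      proof -
        let ?u = "map g [a..<c]"
        have w: "map ?f [a..<Suc c] = ?u @ [c]" using c(2) by simp
        have sorted: "row_sorted (insertion_tableau ?u)" and rich: "rich {a..<c} (row (insertion_tableau ?u))"
          using g(2) U rU by simp_all
        note T = insertion_tableau_append_max[OF sorted rich]
        show ?thesis
          unfolding w
        proof (rule row_sorted_eqI[OF T(1) less.prems(1)])
          fix k
          have "x \<le> c" if "x \<in> row T k" for x
            using rich_Union[OF R, of x] that by auto
          moreover have "k = 0" if "c \<in> row T k"
            using rich_disjoint[OF R m, of k] that 0 by simp
          ultimately show "row (insertion_tableau (?u @ [c])) k = row T k"
            unfolding T(2) g(2) U(2) using m 0 by (auto simp: le_less)
        qed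
      qed
      ultimately show ?thesis using c(1) by blast
    next
      case (Suc L)
      obtain i RU RV d where D: "a \<le> i" "i < c" "rich {a..<i} RU" "rich {Suc i..<c} RV"
        "\<And>k. RV k = {} \<longleftrightarrow> L \<le> k" "d 0 = i" "d (Suc L) = c"
        "\<And>k. k < L \<Longrightarrow> d (Suc k) \<in> RV k" "\<And>k x. k < L \<Longrightarrow> x \<in> RV k \<Longrightarrow> d (Suc k) \<le> x"
        "\<And>k. row T k = RU k \<union> (RV k - {d (Suc k)}) \<union> (if k \<le> Suc L then {d k} else {})"
        using rich_decompose[OF R m[unfolded Suc]] by metis
      obtain U where U: "row_sorted U" "row U = RU"
        using rich_list_tableau[OF D(3)] by auto
      obtain V where V: "row_sorted V" "row V = RV"
        using rich_list_tableau[OF D(4)] by auto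
      obtain g where g: "nc_involution a i g" "insertion_tableau (map g [a..<i]) = U"
        using less.IH[of i U a] U D(1-3) c by auto
      obtain h where h: "nc_involution (Suc i) c h" "insertion_tableau (map h [Suc i..<c]) = V"
        using less.IH[of c V "Suc i"] V D(2,4) c by auto
      define f where "f = (\<lambda>x. if x < i then g x else if x = i then c else if x = c then i else h x)"
      have "nc_involution a (Suc c) f"
        unfolding f_def by (rule nc_involution_add_arc[OF g(1) h(1) D(1,2)])
      moreover have "insertion_tableau (map f [a..<Suc c]) = T"
      proof -
        let ?u = "map g [a..<i]" and ?v = "map h [Suc i..<c]"
        have w: "map f [a..<Suc c] = ?u @ [c] @ ?v @ [i]"
          using map_upt_arc[of a i c f] D(1,2) by (simp add: f_def)
        have IT: "row_sorted (insertion_tableau ?u)" "row_sorted (insertion_tableau ?v)"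
          "rich {a..<i} (row (insertion_tableau ?u))" "rich {Suc i..<c} (row (insertion_tableau ?v))"
          unfolding g(2) h(2) U(2) V(2) using U(1) V(1) D(3,4) by auto
        note T = insertion_tableau_arc[OF IT D(1,2), unfolded g(2) h(2)]
        have L: "length V = L"
          using D(5) row_eq_empty_iff[OF V(1)] V(2) by (metis le_antisym order_refl)
        \<comment> \<open>Away from the two ends, both sides are the minimum of the same row of
          \<open>V\<close>; so the column shifted by insertion is the path \<open>d\<close>.\<close>
        have heads: "(i # map hd V @ [c]) ! k = d k" if "k \<le> Suc L" for k
        proof (cases k)
          case 0
          then show ?thesis using D(6) by simp
        next
          case (Suc j)
          show ?thesis
          proof (cases "j < L")
            case True
            then show ?thesis
              using T(3)[of "d k" j] T(4)[of j] D(8)[of j] D(9)[of j] Suc L V(2)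
              by (metis le_antisym)
          next
            case False
            then show ?thesis using that Suc L D(7) by (simp add: nth_append)
          qed
        qed
        show ?thesis
          unfolding w
        proof (rule row_sorted_eqI[OF T(1) less.prems(1)])
          fix k
          show "row (insertion_tableau (?u @ [c] @ ?v @ [i])) k = row T k"
            using D(5)[of k] heads[of k] heads[of "Suc k"]
            unfolding T(2) D(10) U(2) V(2) L by (cases "k \<le> L") auto
        qed
      qed
      ultimately show ?thesis using c(1) by blast
    qed
  qed
qed

section \<open>Noncrossing matchings as involutions\<close>

text \<open>Blocks through a common point coincide. The case \<open>i = j\<close> is the singleton
  block, so both kinds of blocks are covered.\<close>

lemma matching_involution_eq:
  assumes "partial_matching n P" "{i, j} \<in> P"
  shows "matching_involution P i = j"
proof -
  have unique: "B = C" if "B \<in> P" "C \<in> P" "x \<in> B" "x \<in> C" for B C x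
    using assms(1) that unfolding partial_matching_def partition_on_def disjoint_def by blast
  show ?thesis
  proof (cases "{i} \<in> P")
    case True
    then have "{i} = {i, j}" using unique[of "{i}" "{i, j}" i] assms(2) by simp
    then show ?thesis using True by (auto simp: matching_involution_def)
  next
    case False
    have "(THE j. {i, j} \<in> P) = j"
    proof (rule the_equality[of _ j])
      fix k assume "{i, k} \<in> P"
      then have "{i, k} = {i, j}" using unique[of "{i, k}" "{i, j}" i] assms(2) by simp
      then show "k = j" by (metis doubleton_eq_iff)
    qed (rule assms(2))
    then show ?thesis using False by (simp add: matching_involution_def)
  qed
qed

lemma partial_matching_block:
  assumes "partial_matching n P" "i \<in> {1..n}"
  shows "{i, matching_involution P i} \<in> P"
proof -
  obtain B where B: "B \<in> P" "i \<in> B"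
    using assms unfolding partial_matching_def partition_on_def by blast
  then consider "card B = 1" | "card B = 2" using assms(1) unfolding partial_matching_def by blast
  then obtain j where "B = {i, j}"
    using B(2) by cases (auto simp: card_1_singleton_iff card_2_iff)
  then show ?thesis using B(1) matching_involution_eq[OF assms(1)] by metis
qed

text \<open>The comparison is made between words because the values of \<open>f\<close> outside
  \<open>{1..n}\<close> are arbitrary.\<close>

lemma matching_words:
  "{matching_word n P | P. noncrossing_partial_matching n P} =
   {map f [1..<Suc n] | f. nc_involution 1 (Suc n) f}"
proof (intro set_eqI iffI)
  fix w assume "w \<in> {matching_word n P | P. noncrossing_partial_matching n P}"
  then obtain P where P: "partial_matching n P" "\<forall>a\<in>arcs P. \<forall>b\<in>arcs P. \<not> crossing a b"
    and w: "w = map (matching_involution P) [1..<Suc n]"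
    unfolding noncrossing_partial_matching_def matching_word_def by blast
  let ?f = "matching_involution P"
  have "nc_involution 1 (Suc n) ?f"
    unfolding nc_involution_def
  proof (intro conjI ballI impI)
    fix x assume "x \<in> {1..<Suc n}"
    then have x: "x \<in> {1..n}" by auto
    note block = partial_matching_block[OF P(1) x]
    then have "{x, ?f x} \<subseteq> {1..n}"
      using P(1) unfolding partial_matching_def partition_on_def by blast
    then show "?f x \<in> {1..<Suc n}" by auto
    show "?f (?f x) = x"
      using matching_involution_eq[OF P(1)] block by (metis insert_commute)
    fix y assume y: "y \<in> {1..<Suc n}" and xy: "x < y \<and> y < ?f x"
    show "?f y \<le> ?f x"
    proof (rule ccontr)
      assume less: "\<not> ?f y \<le> ?f x"
      have "y \<in> {1..n}" using y by auto
      then have "(x, ?f x) \<in> arcs P" "(y, ?f y) \<in> arcs P"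
        using block partial_matching_block[OF P(1), of y] xy less by (auto simp: arcs_def)
      then have "\<not> crossing (x, ?f x) (y, ?f y)" using P(2) by blast
      then show False using xy less by (simp add: crossing_def)
    qed
  qed
  then show "w \<in> {map f [1..<Suc n] | f. nc_involution 1 (Suc n) f}"
    using w by blast
next
  fix w assume "w \<in> {map f [1..<Suc n] | f. nc_involution 1 (Suc n) f}"
  then obtain f where f: "nc_involution 1 (Suc n) f" and w: "w = map f [1..<Suc n]" by blast
  \<comment> \<open>A fixed point gives \<open>{x, x} = {x}\<close>, a block of size one.\<close>
  define P where "P = (\<lambda>x. {x, f x}) ` {1..n}"
  note D = nc_involutionD[OF f]
  have block: "b = f a \<and> a \<in> {1..n}" if "{a, b} \<in> P" for a b
    using that D(3) D(1,2) by (force simp: P_def doubleton_eq_iff)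
  have pm: "partial_matching n P"
    unfolding partial_matching_def
  proof (intro conjI ballI partition_onI)
    show "\<Union>P = {1..n}" using D(1,2) by (force simp: P_def)
    show "{} \<notin> P" by (auto simp: P_def)
    show "disjnt p q" if pq: "p \<in> P" "q \<in> P" "p \<noteq> q" for p q
    proof -
      obtain x y where xy: "p = {x, f x}" "q = {y, f y}" "x \<in> {1..n}" "y \<in> {1..n}"
        using pq(1,2) unfolding P_def by blast
      then have "f (f x) = x" "f (f y) = y" using D(3) by auto
      then show ?thesis using pq(3) unfolding xy disjnt_def by auto
    qed
    show "card B = 1 \<or> card B = 2" if B: "B \<in> P" for B
    proof -
      obtain x where "B = {x, f x}" using B unfolding P_def by blast
      then show ?thesis by (cases "f x = x") auto
    qed
  qed
  moreover have "\<not> crossing p q" if pq: "p \<in> arcs P" "q \<in> arcs P" for p q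
  proof -
    obtain x y where xy: "p = (x, f x)" "q = (y, f y)" "x \<in> {1..n}"
      using pq block by (auto simp: arcs_def)
    then show ?thesis
      using nc_involution_nesting[OF f, of x y] by (auto simp: crossing_def)
  qed
  moreover have "w = matching_word n P"
    unfolding w matching_word_def
  proof (rule map_cong[OF refl])
    fix x assume "x \<in> set [1..<Suc n]"
    then have "{x, f x} \<in> P" by (auto simp: P_def)
    then show "f x = matching_involution P x" using matching_involution_eq[OF pm] by simp
  qed
  ultimately show "w \<in> {matching_word n P | P. noncrossing_partial_matching n P}"
    unfolding noncrossing_partial_matching_def by blast
qed

theorem theorem1p1:
  fixes n :: nat
  assumes "n \<ge> 1"
  shows "{insertion_tableau (matching_word n P) | P. noncrossing_partial_matching n P}
       = {T. richardson_tableau n T}"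
proof -
  have "{insertion_tableau (matching_word n P) | P. noncrossing_partial_matching n P} =
    insertion_tableau ` {matching_word n P | P. noncrossing_partial_matching n P}"
    by blast
  also have "\<dots> = {insertion_tableau (map f [1..<Suc n]) | f. nc_involution 1 (Suc n) f}"
    unfolding matching_words by blast
  \<comment> \<open>The two inclusions are \<open>rich_insertion_tableau\<close> and
    \<open>rich_obtain_nc_involution\<close>.\<close>
  also have "\<dots> = {T. row_sorted T \<and> rich {1..<Suc n} (row T)}"
    using rich_insertion_tableau[of 1 "Suc n"] rich_obtain_nc_involution[of _ 1 "Suc n"] by fastforce
  finally show ?thesis
    by (simp add: richardson_tableau_iff atLeastLessThanSuc_atLeastAtMost)
qed

end
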